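(* Let $X\xrightarrow{k}A\xrightarrow{f}B$, with section $s\colon B\to A$ of $f$, be a split extension in $\mathsf{OrdGrp}$, where $A$ is identified, as a group, with the semidirect product $X\rtimes_\varphi B$ for the action $\varphi_b(x)=s(b)+k(x)-s(b)$ (identified with an element of $X$), so that $k(x)=(x,0)$, $f(x,b)=b$, $s(b)=(0,b)$. Let $P$ be the positive cone of $A$, let $P_X$, $P_B$ be the positive cones of $X$ and $B$, and let $P_{\prod}=P_X\times P_B$. Then: (1) $(f,s)$ is a rali if and only if $P=P_{\prod}$; (2) $(f,s)$ is strong if and only if $P$ is minimal, i.e. $P=\langle P_{\prod}\rangle$ is the positive cone generated by $P_{\prod}$.
   Context: "Order" means preorder (reflexive and transitive, not necessarily antisymmetric). An ordered group is a (not necessarily abelian) group, written additively, with an order $\leq$ for which addition is monotone. The positive cone of an ordered group $X$ is $P_X=\{x\in X: x\geq 0\}$; a positive cone on a group is a submonoid closed under conjugation, and positive cones correspond bijectively to group orders (with $x\le y$ iff $y-x\in P$). For a subset $S$ of a group, $\langle S\rangle$ denotes the least positive cone containing $S$ (close $S$ under conjugation and then under addition). $\mathsf{OrdGrp}$ is the category of ordered groups and monotone group homomorphisms. A split extension in $\mathsf{OrdGrp}$ is a sequence $X\xrightarrow{k}A\xrightarrow{f}B$ with $k$ a kernel of $f$ and $f$ a cokernel of $k$, together with a morphism $s\colon B\to A$ such that $f\cdot s=\mathrm{id}_B$; equivalently one speaks of the point $(f,s)$ with kernel $k$. (A kernel in $\mathsf{OrdGrp}$ is a group-theoretic kernel carrying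 the induced order.) The semidirect product $X\rtimes_\varphi B$ has underlying set $X\times B$ and operation $(x,b)+(x',b')=(x+\varphi_b(x'),b+b')$. For morphisms $g,h\colon Y\to Z$ in $\mathsf{OrdGrp}$, $g\leq h$ means $g(y)\leq h(y)$ for every positive $y\in Y$. The point $(f,s)$ is a rali (right adjoint and left inverse) if $f$ is right adjoint and left inverse to $s$ for this enrichment, i.e. $f\cdot s=\mathrm{id}_B$ and $s\cdot f\leq\mathrm{id}_A$. The point $(f,s)$ is strong if $k$ and $s$ are jointly strongly epimorphic, i.e. whenever $k$ and $s$ both factor through a monomorphism $m\colon M\to A$ in $\mathsf{OrdGrp}$, $m$ is an isomorphism in $\mathsf{OrdGrp}$. *)

theory Defs
  imports "HOL-Algebra.Coset"
begin

text \<open>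
  The groups are those of \<^theory>\<open>HOL-Algebra.Group\<close>, hence not necessarily abelian; the
  additive notation $x + y$, $0$, $-x$ is rendered by that library's \<open>\<otimes>\<close>, \<open>\<one>\<close>, \<open>inv\<close>.
  Functions between carriers matter, and are compared, on carriers only.
\<close>

record 'a ordgrp = "'a monoid" +
  le :: "'a \<Rightarrow> 'a \<Rightarrow> bool"  (infixl "\<preceq>\<index>" 50)

locale ordered_group = group G for G :: "'a ordgrp" (structure) +
  assumes le_refl: "reflp_on (carrier G) (\<preceq>)"
    and le_trans: "transp_on (carrier G) (\<preceq>)"
    and mult_mono: "\<lbrakk>x \<in> carrier G; x' \<in> carrier G; y \<in> carrier G; y' \<in> carrier G;
      x \<preceq> x'; y \<preceq> y'\<rbrakk> \<Longrightarrow> x \<otimes> y \<preceq> x' \<otimes> y'"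

definition pos_cone :: "'a ordgrp \<Rightarrow> 'a set" where
  "pos_cone G = {x \<in> carrier G. \<one>\<^bsub>G\<^esub> \<preceq>\<^bsub>G\<^esub> x}"

definition positive_cone :: "('a, 'm) monoid_scheme \<Rightarrow> 'a set \<Rightarrow> bool" where
  "positive_cone G P \<longleftrightarrow> submonoid P G \<and>
     (\<forall>g\<in>carrier G. \<forall>x\<in>P. g \<otimes>\<^bsub>G\<^esub> x \<otimes>\<^bsub>G\<^esub> inv\<^bsub>G\<^esub> g \<in> P)"

definition gen_cone :: "('a, 'm) monoid_scheme \<Rightarrow> 'a set \<Rightarrow> 'a set" where
  "gen_cone G S = \<Inter>{P. positive_cone G P \<and> S \<subseteq> P}"


subsection \<open>The category OrdGrp\<close>

definition ordhom :: "'a ordgrp \<Rightarrow> 'b ordgrp \<Rightarrow> ('a \<Rightarrow> 'b) set" where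
  "ordhom G H = {h \<in> hom G H. \<forall>x\<in>carrier G. \<forall>y\<in>carrier G. x \<preceq>\<^bsub>G\<^esub> y \<longrightarrow> h x \<preceq>\<^bsub>H\<^esub> h y}"

definition ordiso :: "'a ordgrp \<Rightarrow> 'b ordgrp \<Rightarrow> ('a \<Rightarrow> 'b) \<Rightarrow> bool" where
  "ordiso G H h \<longleftrightarrow> h \<in> ordhom G H \<and>
     (\<exists>h'\<in>ordhom H G. (\<forall>x\<in>carrier G. h' (h x) = x) \<and> (\<forall>y\<in>carrier H. h (h' y) = y))"

text \<open>
  HOL cannot quantify over the carrier type of an object inside a formula, so each universal
  property below is tested against objects over one fixed carrier type. The lemmas
  \<open>ordmono_iff\<close>, \<open>jointly_strongly_epi_any\<close> and \<open>split_cokernel_any\<close> show that the test objects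
  over all other carrier types are then covered as well.
\<close>

definition ordmono :: "'m ordgrp \<Rightarrow> 'a ordgrp \<Rightarrow> ('m \<Rightarrow> 'a) \<Rightarrow> bool" where
  "ordmono M A m \<longleftrightarrow> m \<in> ordhom M A \<and>
     (\<forall>(Y :: 'm ordgrp) g h. ordered_group Y \<longrightarrow> g \<in> ordhom Y M \<longrightarrow> h \<in> ordhom Y M \<longrightarrow>
        (\<forall>y\<in>carrier Y. m (g y) = m (h y)) \<longrightarrow> (\<forall>y\<in>carrier Y. g y = h y))"

lemma ordhomD:
  assumes "h \<in> ordhom G H"
  shows "h \<in> hom G H" "\<And>x. x \<in> carrier G \<Longrightarrow> h x \<in> carrier H"
    "\<And>x y. x \<in> carrier G \<Longrightarrow> y \<in> carrier G \<Longrightarrow> h (x \<otimes>\<^bsub>G\<^esub> y) = h x \<otimes>\<^bsub>H\<^esub> h y"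
    "\<And>x y. x \<in> carrier G \<Longrightarrow> y \<in> carrier G \<Longrightarrow> x \<preceq>\<^bsub>G\<^esub> y \<Longrightarrow> h x \<preceq>\<^bsub>H\<^esub> h y"
  using assms by (auto simp: ordhom_def hom_def Pi_iff)

lemma ordhom_comp: "g \<in> ordhom G H \<Longrightarrow> h \<in> ordhom H K \<Longrightarrow> h \<circ> g \<in> ordhom G K"
  by (auto simp: ordhom_def hom_def Pi_iff)

lemma ordhom_group_hom:
  assumes "ordered_group G" "ordered_group H" "h \<in> ordhom G H"
  shows "group_hom G H h"
  using assms by (auto simp: ordhom_def ordered_group_def group_hom_def group_hom_axioms_def)

lemma ordmono_iff:
  fixes M :: "'m ordgrp" and A :: "'a ordgrp"
  assumes M: "ordered_group M" and A: "ordered_group A"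
  shows "ordmono M A m \<longleftrightarrow> m \<in> ordhom M A \<and> inj_on m (carrier M)"
proof (intro iffI conjI)
  assume mono: "ordmono M A m"
  then show m: "m \<in> ordhom M A" by (simp add: ordmono_def)
  interpret M: ordered_group M by (rule M)
  interpret h: group_hom M A m by (rule ordhom_group_hom[OF M A m])
  let ?K = "kernel M A m"
  let ?Y = "M\<lparr>carrier := ?K\<rparr>"
  have sub: "?K \<subseteq> carrier M" by (auto simp: kernel_def)
  have gr: "group ?Y" by (rule M.subgroup_imp_group[OF h.subgroup_kernel])
  have Y: "ordered_group ?Y"
  proof (intro ordered_group.intro[OF gr] ordered_group_axioms.intro)
    show "reflp_on (carrier ?Y) (le ?Y)"
      using M.le_refl sub by (auto simp: reflp_on_def)
    show "transp_on (carrier ?Y) (le ?Y)"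
      using M.le_trans sub by (simp add: transp_on_def) (meson subsetD)
  qed (simp add: kernel_def M.mult_mono)
  have 1: "(\<lambda>x. x) \<in> ordhom ?Y M"
    using sub by (auto simp: ordhom_def hom_def)
  have 2: "(\<lambda>x. \<one>\<^bsub>M\<^esub>) \<in> ordhom ?Y M"
    using M.le_refl by (auto simp: ordhom_def hom_def reflp_on_def)
  have "x = \<one>\<^bsub>M\<^esub>" if "x \<in> ?K" for x
  proof -
    have "\<forall>y\<in>carrier ?Y. m y = m \<one>\<^bsub>M\<^esub>" by (auto simp: kernel_def)
    then have "\<forall>y\<in>carrier ?Y. y = \<one>\<^bsub>M\<^esub>"
      using mono Y 1 2 unfolding ordmono_def by blast
    then show ?thesis using that by simp
  qed
  then show "inj_on m (carrier M)"
    using h.inj_on_one_iff by (auto simp: kernel_def)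
next
  assume "m \<in> ordhom M A \<and> inj_on m (carrier M)"
  then show "ordmono M A m"
    unfolding ordmono_def by (meson inj_onD ordhomD(2))
qed

definition factors_through ::
    "'x ordgrp \<Rightarrow> 'm ordgrp \<Rightarrow> ('x \<Rightarrow> 'a) \<Rightarrow> ('m \<Rightarrow> 'a) \<Rightarrow> bool" where
  "factors_through X M k m \<longleftrightarrow> (\<exists>k'\<in>ordhom X M. \<forall>x\<in>carrier X. m (k' x) = k x)"

definition jointly_strongly_epi ::
    "'x ordgrp \<Rightarrow> 'b ordgrp \<Rightarrow> 'a ordgrp \<Rightarrow> ('x \<Rightarrow> 'a) \<Rightarrow> ('b \<Rightarrow> 'a) \<Rightarrow> bool" where
  "jointly_strongly_epi X B A k s \<longleftrightarrow>
     (\<forall>(M :: 'a ordgrp) m. ordered_group M \<longrightarrow> ordmono M A m \<longrightarrow>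
        factors_through X M k m \<longrightarrow> factors_through B M s m \<longrightarrow> ordiso M A m)"

lemma jointly_strongly_epi_any:
  fixes M :: "'m ordgrp" and A :: "'a ordgrp"
  assumes epi: "jointly_strongly_epi X B A k s"
    and M: "ordered_group M" and A: "ordered_group A" and mono: "ordmono M A m"
    and fk: "factors_through X M k m" and fs: "factors_through B M s m"
  shows "ordiso M A m"
proof -
  have m: "m \<in> ordhom M A" and inj: "inj_on m (carrier M)"
    using mono ordmono_iff[OF M A] by auto
  interpret M: ordered_group M by (rule M)
  interpret A: ordered_group A by (rule A)
  interpret h: group_hom M A m by (rule ordhom_group_hom[OF M A m])
  define n where "n = inv_into (carrier M) m"
  define N :: "'a ordgrp" where
    "N = A\<lparr>carrier := m ` carrier M, le := (\<lambda>x y. le M (n x) (n y))\<rparr>"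
  have n [simp]: "n (m x) = x" if "x \<in> carrier M" for x
    using inj that by (simp add: n_def)
  have cN: "carrier N = m ` carrier M" and mN: "mult N = mult A" and oN: "one N = one A"
    and leN: "le N = (\<lambda>x y. le M (n x) (n y))"
    by (simp_all add: N_def)
  have n_mult: "n (m x \<otimes>\<^bsub>A\<^esub> m y) = x \<otimes>\<^bsub>M\<^esub> y" if "x \<in> carrier M" "y \<in> carrier M" for x y
    using n[of "x \<otimes>\<^bsub>M\<^esub> y"] that by simp
  have gN: "group N"
  proof (rule groupI)
    fix x assume "x \<in> carrier N"
    then obtain z where z: "z \<in> carrier M" "x = m z" by (auto simp: cN)
    then have "m (inv\<^bsub>M\<^esub> z) \<otimes>\<^bsub>N\<^esub> x = \<one>\<^bsub>N\<^esub>" by (simp add: mN oN)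
    then show "\<exists>y\<in>carrier N. y \<otimes>\<^bsub>N\<^esub> x = \<one>\<^bsub>N\<^esub>"
      using z by (intro bexI[of _ "m (inv\<^bsub>M\<^esub> z)"]) (simp_all add: cN del: h.hom_inv)
  next
    fix x y assume "x \<in> carrier N" "y \<in> carrier N"
    then obtain u v where "u \<in> carrier M" "v \<in> carrier M" "x = m u" "y = m v"
      by (auto simp: cN)
    then show "x \<otimes>\<^bsub>N\<^esub> y \<in> carrier N"
      by (simp add: cN mN flip: h.hom_mult)
  next
    show "\<one>\<^bsub>N\<^esub> \<in> carrier N"
      using h.hom_one M.one_closed by (metis cN oN image_eqI)
  qed (auto simp: cN mN oN A.m_assoc)
  have N: "ordered_group N"
  proof (intro ordered_group.intro[OF gN] ordered_group_axioms.intro)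
    show "reflp_on (carrier N) (le N)"
      using M.le_refl by (auto simp: reflp_on_def cN leN)
    show "transp_on (carrier N) (le N)"
    proof (rule transp_onI)
      fix x y z assume "x \<in> carrier N" "y \<in> carrier N" "z \<in> carrier N" "le N x y" "le N y z"
      then show "le N x z"
        using transp_onD[OF M.le_trans, of "n x" "n y" "n z"] by (auto simp: cN leN)
    qed
  qed (auto simp: cN leN mN n_mult intro: M.mult_mono)
  have id: "(\<lambda>x. x) \<in> ordhom N A"
    using ordhomD(4)[OF m] by (auto simp: ordhom_def hom_def cN mN leN)
  then have monoN: "ordmono N A (\<lambda>x. x)"
    by (simp add: ordmono_iff[OF N A])
  have mMN: "m \<in> ordhom M N" by (auto simp: ordhom_def hom_def cN mN leN)
  have fac: "factors_through Z N l (\<lambda>x. x)" if l: "factors_through Z M l m"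
    for Z :: "'z ordgrp" and l
  proof -
    obtain l' where l': "l' \<in> ordhom Z M" "\<forall>x\<in>carrier Z. m (l' x) = l x"
      using l by (auto simp: factors_through_def)
    have "m \<circ> l' \<in> ordhom Z N" by (rule ordhom_comp[OF l'(1) mMN])
    with l' show ?thesis unfolding factors_through_def by (intro bexI[of _ "m \<circ> l'"]) auto
  qed
  have "ordiso N A (\<lambda>x. x)"
    using epi N monoN fac[OF fk] fac[OF fs] unfolding jointly_strongly_epi_def by blast
  then obtain i where i: "i \<in> ordhom A N" "\<forall>y\<in>carrier A. i y = y"
    unfolding ordiso_def by auto
  then have surj: "carrier A = m ` carrier M"
    using ordhomD(2)[OF i(1)] ordhomD(2)[OF m] by (force simp: cN)
  have "n \<in> ordhom A M"
  proof -
    have "n \<in> hom A M" by (auto simp: hom_def surj n_mult)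
    moreover have "le M (n x) (n y)" if "x \<in> carrier A" "y \<in> carrier A" "le A x y" for x y
      using ordhomD(4)[OF i(1) that] i(2) that by (simp add: leN)
    ultimately show ?thesis by (simp add: ordhom_def)
  qed
  then show ?thesis unfolding ordiso_def using m surj by (intro conjI bexI[of _ n]) auto
qed

definition is_kernel ::
    "'x ordgrp \<Rightarrow> 'a ordgrp \<Rightarrow> 'b ordgrp \<Rightarrow> ('x \<Rightarrow> 'a) \<Rightarrow> ('a \<Rightarrow> 'b) \<Rightarrow> bool" where
  "is_kernel X A B k f \<longleftrightarrow> k \<in> ordhom X A \<and> inj_on k (carrier X) \<and>
     k ` carrier X = kernel A B f \<and>
     (\<forall>x\<in>carrier X. \<forall>y\<in>carrier X. x \<preceq>\<^bsub>X\<^esub> y \<longleftrightarrow> k x \<preceq>\<^bsub>A\<^esub> k y)"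

definition is_cokernel ::
    "'x ordgrp \<Rightarrow> 'a ordgrp \<Rightarrow> 'b ordgrp \<Rightarrow> ('x \<Rightarrow> 'a) \<Rightarrow> ('a \<Rightarrow> 'b) \<Rightarrow> bool" where
  "is_cokernel X A B k f \<longleftrightarrow> f \<in> ordhom A B \<and> (\<forall>x\<in>carrier X. f (k x) = \<one>\<^bsub>B\<^esub>) \<and>
     (\<forall>(C :: 'a ordgrp) g. ordered_group C \<longrightarrow> g \<in> ordhom A C \<longrightarrow>
        (\<forall>x\<in>carrier X. g (k x) = \<one>\<^bsub>C\<^esub>) \<longrightarrow>
        (\<exists>h\<in>ordhom B C. (\<forall>a\<in>carrier A. h (f a) = g a) \<and>
           (\<forall>h'\<in>ordhom B C. (\<forall>a\<in>carrier A. h' (f a) = g a) \<longrightarrow> (\<forall>b\<in>carrier B. h' b = h b))))"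

lemma split_cokernel_any:
  fixes C :: "'c ordgrp"
  assumes X: "ordered_group X" and A: "ordered_group A" and B: "ordered_group B"
    and C: "ordered_group C"
    and ker: "is_kernel X A B k f" and f: "f \<in> ordhom A B" and s: "s \<in> ordhom B A"
    and fs: "\<And>b. b \<in> carrier B \<Longrightarrow> f (s b) = b"
    and g: "g \<in> ordhom A C" and gk: "\<And>x. x \<in> carrier X \<Longrightarrow> g (k x) = \<one>\<^bsub>C\<^esub>"
  shows "\<exists>h\<in>ordhom B C. (\<forall>a\<in>carrier A. h (f a) = g a) \<and>
    (\<forall>h'\<in>ordhom B C. (\<forall>a\<in>carrier A. h' (f a) = g a) \<longrightarrow> (\<forall>b\<in>carrier B. h' b = h b))"
proof (intro bexI[of _ "g \<circ> s"] conjI ballI impI)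
  interpret f: group_hom A B f by (rule ordhom_group_hom[OF A B f])
  interpret g: group_hom A C g by (rule ordhom_group_hom[OF A C g])
  show "g \<circ> s \<in> ordhom B C" by (rule ordhom_comp[OF s g])
  show "(g \<circ> s) (f a) = g a" if a: "a \<in> carrier A" for a
  proof -
    have sfa: "s (f a) \<in> carrier A" using a ordhomD(2)[OF s] by simp
    have "a \<otimes>\<^bsub>A\<^esub> inv\<^bsub>A\<^esub> (s (f a)) \<in> kernel A B f"
      using a sfa by (simp add: kernel_def fs)
    then obtain x where "x \<in> carrier X" "k x = a \<otimes>\<^bsub>A\<^esub> inv\<^bsub>A\<^esub> (s (f a))"
      using ker unfolding is_kernel_def by (metis imageE)
    then have "g (a \<otimes>\<^bsub>A\<^esub> inv\<^bsub>A\<^esub> (s (f a))) = \<one>\<^bsub>C\<^esub>" using gk by metis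
    then have "g a \<otimes>\<^bsub>C\<^esub> inv\<^bsub>C\<^esub> (g (s (f a))) = \<one>\<^bsub>C\<^esub>" using a sfa by simp
    then have "g a = g (s (f a))"
      using a sfa g.H.inv_solve_right'[of "\<one>\<^bsub>C\<^esub>" "g a" "g (s (f a))"] by simp
    then show ?thesis by simp
  qed
  show "h' b = (g \<circ> s) b" if "\<forall>a\<in>carrier A. h' (f a) = g a" "b \<in> carrier B" for h' b
    using that ordhomD(2)[OF s] fs by (metis comp_apply)
qed

definition split_extension ::
    "'x ordgrp \<Rightarrow> 'a ordgrp \<Rightarrow> 'b ordgrp \<Rightarrow> ('x \<Rightarrow> 'a) \<Rightarrow> ('a \<Rightarrow> 'b) \<Rightarrow> ('b \<Rightarrow> 'a) \<Rightarrow> bool" where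
  "split_extension X A B k f s \<longleftrightarrow>
     ordered_group X \<and> ordered_group A \<and> ordered_group B \<and>
     k \<in> ordhom X A \<and> f \<in> ordhom A B \<and> s \<in> ordhom B A \<and>
     is_kernel X A B k f \<and> is_cokernel X A B k f \<and> (\<forall>b\<in>carrier B. f (s b) = b)"

definition hom_le :: "'y ordgrp \<Rightarrow> 'z ordgrp \<Rightarrow> ('y \<Rightarrow> 'z) \<Rightarrow> ('y \<Rightarrow> 'z) \<Rightarrow> bool" where
  "hom_le Y Z g h \<longleftrightarrow> (\<forall>y\<in>pos_cone Y. g y \<preceq>\<^bsub>Z\<^esub> h y)"

definition rali :: "'a ordgrp \<Rightarrow> 'b ordgrp \<Rightarrow> ('a \<Rightarrow> 'b) \<Rightarrow> ('b \<Rightarrow> 'a) \<Rightarrow> bool" where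
  "rali A B f s \<longleftrightarrow> (\<forall>b\<in>carrier B. f (s b) = b) \<and> hom_le A A (s \<circ> f) id"

text \<open>
  For a point \<open>(f, s)\<close> the kernel \<open>k\<close> enters only up to isomorphism, so it is passed explicitly.
\<close>
definition strong_point ::
    "'x ordgrp \<Rightarrow> 'a ordgrp \<Rightarrow> 'b ordgrp \<Rightarrow> ('x \<Rightarrow> 'a) \<Rightarrow> ('a \<Rightarrow> 'b) \<Rightarrow> ('b \<Rightarrow> 'a) \<Rightarrow> bool" where
  "strong_point X A B k f s \<longleftrightarrow> is_kernel X A B k f \<and> jointly_strongly_epi X B A k s"


subsection \<open>Semidirect products and the identification of the middle object\<close>

definition semidirect ::
    "('x, 'm) monoid_scheme \<Rightarrow> ('b \<Rightarrow> 'x \<Rightarrow> 'x) \<Rightarrow> ('b, 'n) monoid_scheme \<Rightarrow> ('x \<times> 'b) monoid" where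
  "semidirect X \<phi> B =
     \<lparr>carrier = carrier X \<times> carrier B,
      mult = (\<lambda>(x, b) (x', b'). (x \<otimes>\<^bsub>X\<^esub> \<phi> b x', b \<otimes>\<^bsub>B\<^esub> b')),
      one = (\<one>\<^bsub>X\<^esub>, \<one>\<^bsub>B\<^esub>)\<rparr>"

definition conj_action ::
    "'x ordgrp \<Rightarrow> 'a ordgrp \<Rightarrow> ('x \<Rightarrow> 'a) \<Rightarrow> ('b \<Rightarrow> 'a) \<Rightarrow> 'b \<Rightarrow> 'x \<Rightarrow> 'x" where
  "conj_action X A k s b x = inv_into (carrier X) k (s b \<otimes>\<^bsub>A\<^esub> k x \<otimes>\<^bsub>A\<^esub> inv\<^bsub>A\<^esub> (s b))"

text \<open>
  The group isomorphism from the semidirect product of \<open>X\<close> and \<open>B\<close> onto \<open>A\<close> (lemma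
  \<open>ident_iso\<close>) along which \<open>A\<close> is identified with the semidirect product: it turns \<open>k\<close>, \<open>f\<close>, \<open>s\<close>
  into $x \mapsto (x,0)$, $(x,b) \mapsto b$, $b \mapsto (0,b)$ (lemma \<open>ident_maps\<close>).
\<close>
definition ident :: "'a ordgrp \<Rightarrow> ('x \<Rightarrow> 'a) \<Rightarrow> ('b \<Rightarrow> 'a) \<Rightarrow> 'x \<times> 'b \<Rightarrow> 'a" where
  "ident A k s = (\<lambda>(x, b). k x \<otimes>\<^bsub>A\<^esub> s b)"

text \<open>The positive cone of \<open>A\<close>, read inside the semidirect product via \<open>ident\<close>.\<close>
definition ident_cone ::
    "'x ordgrp \<Rightarrow> 'a ordgrp \<Rightarrow> 'b ordgrp \<Rightarrow> ('x \<Rightarrow> 'a) \<Rightarrow> ('b \<Rightarrow> 'a) \<Rightarrow> ('x \<times> 'b) set" where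
  "ident_cone X A B k s = {p \<in> carrier X \<times> carrier B. ident A k s p \<in> pos_cone A}"

lemma split_extensionD:
  assumes "split_extension X A B k f s"
  shows "ordered_group X" "ordered_group A" "ordered_group B"
    "k \<in> ordhom X A" "f \<in> ordhom A B" "s \<in> ordhom B A" "is_kernel X A B k f"
    "inj_on k (carrier X)" "k ` carrier X = kernel A B f"
    "\<And>b. b \<in> carrier B \<Longrightarrow> f (s b) = b"
  using assms by (auto simp: split_extension_def is_kernel_def)

lemma conj_action:
  assumes ext: "split_extension X A B k f s" and x: "x \<in> carrier X" and b: "b \<in> carrier B"
  shows "conj_action X A k s b x \<in> carrier X"
    "k (conj_action X A k s b x) = s b \<otimes>\<^bsub>A\<^esub> k x \<otimes>\<^bsub>A\<^esub> inv\<^bsub>A\<^esub> (s b)"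
proof -
  note D = split_extensionD[OF ext]
  interpret f: group_hom A B f by (rule ordhom_group_hom[OF D(2,3,5)])
  have kx: "k x \<in> kernel A B f" using x D(9) by blast
  have sb: "s b \<in> carrier A" using b ordhomD(2)[OF D(6)] by simp
  have "s b \<otimes>\<^bsub>A\<^esub> k x \<otimes>\<^bsub>A\<^esub> inv\<^bsub>A\<^esub> (s b) \<in> k ` carrier X"
    using kx sb b D(10)[OF b] unfolding D(9) by (simp add: kernel_def)
  then show "conj_action X A k s b x \<in> carrier X"
    "k (conj_action X A k s b x) = s b \<otimes>\<^bsub>A\<^esub> k x \<otimes>\<^bsub>A\<^esub> inv\<^bsub>A\<^esub> (s b)"
    by (simp_all add: conj_action_def inv_into_into f_inv_into_f)
qed

lemma ident_maps:
  assumes ext: "split_extension X A B k f s"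
  shows "x \<in> carrier X \<Longrightarrow> ident A k s (x, \<one>\<^bsub>B\<^esub>) = k x"
    "b \<in> carrier B \<Longrightarrow> ident A k s (\<one>\<^bsub>X\<^esub>, b) = s b"
    "x \<in> carrier X \<Longrightarrow> b \<in> carrier B \<Longrightarrow> f (ident A k s (x, b)) = b"
proof -
  note D = split_extensionD[OF ext]
  interpret f: group_hom A B f by (rule ordhom_group_hom[OF D(2,3,5)])
  interpret k: group_hom X A k by (rule ordhom_group_hom[OF D(1,2,4)])
  interpret s: group_hom B A s by (rule ordhom_group_hom[OF D(3,2,6)])
  show "x \<in> carrier X \<Longrightarrow> ident A k s (x, \<one>\<^bsub>B\<^esub>) = k x"
    "b \<in> carrier B \<Longrightarrow> ident A k s (\<one>\<^bsub>X\<^esub>, b) = s b"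
    by (simp_all add: ident_def)
  have "f (k x) = \<one>\<^bsub>B\<^esub>" if "x \<in> carrier X" for x
    using that D(9) by (auto simp: kernel_def)
  then show "x \<in> carrier X \<Longrightarrow> b \<in> carrier B \<Longrightarrow> f (ident A k s (x, b)) = b"
    using D(10) by (simp add: ident_def)
qed

lemma ident_iso:
  assumes ext: "split_extension X A B k f s"
  shows "ident A k s \<in> iso (semidirect X (conj_action X A k s) B) A"
proof -
  note D = split_extensionD[OF ext]
  interpret f: group_hom A B f by (rule ordhom_group_hom[OF D(2,3,5)])
  interpret k: group_hom X A k by (rule ordhom_group_hom[OF D(1,2,4)])
  interpret s: group_hom B A s by (rule ordhom_group_hom[OF D(3,2,6)])
  let ?\<phi> = "conj_action X A k s"
  have "ident A k s \<in> hom (semidirect X ?\<phi> B) A"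
  proof (rule homI)
    fix p q assume "p \<in> carrier (semidirect X ?\<phi> B)" "q \<in> carrier (semidirect X ?\<phi> B)"
    then obtain x b x' b' where pq: "p = (x, b)" "q = (x', b')" "x \<in> carrier X" "x' \<in> carrier X"
        "b \<in> carrier B" "b' \<in> carrier B"
      by (auto simp: semidirect_def)
    have "k x \<otimes>\<^bsub>A\<^esub> (s b \<otimes>\<^bsub>A\<^esub> k x' \<otimes>\<^bsub>A\<^esub> inv\<^bsub>A\<^esub> (s b)) \<otimes>\<^bsub>A\<^esub> (s b \<otimes>\<^bsub>A\<^esub> s b') =
        k x \<otimes>\<^bsub>A\<^esub> s b \<otimes>\<^bsub>A\<^esub> k x' \<otimes>\<^bsub>A\<^esub> (inv\<^bsub>A\<^esub> (s b) \<otimes>\<^bsub>A\<^esub> s b) \<otimes>\<^bsub>A\<^esub> s b'"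
      using pq by (simp only: f.G.m_assoc f.G.m_closed f.G.inv_closed k.hom_closed s.hom_closed)
    then show "ident A k s (p \<otimes>\<^bsub>semidirect X ?\<phi> B\<^esub> q) = ident A k s p \<otimes>\<^bsub>A\<^esub> ident A k s q"
      using pq conj_action[OF ext]
      by (simp add: semidirect_def ident_def f.G.m_assoc)
  qed (auto simp: semidirect_def ident_def)
  moreover have "bij_betw (ident A k s) (carrier X \<times> carrier B) (carrier A)"
    unfolding bij_betw_def
  proof
    show "inj_on (ident A k s) (carrier X \<times> carrier B)"
    proof (rule inj_onI, clarify)
      fix x b x' b' assume *: "x \<in> carrier X" "b \<in> carrier B" "x' \<in> carrier X" "b' \<in> carrier B"
        "ident A k s (x, b) = ident A k s (x', b')"
      then have b: "b = b'" using ident_maps(3)[OF ext] by metis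
      then have "k x = k x'" using * by (simp add: ident_def)
      then show "x = x' \<and> b = b'" using b D(8) * by (auto dest: inj_onD)
    qed
    show "ident A k s ` (carrier X \<times> carrier B) = carrier A"
    proof (intro equalityI subsetI)
      fix a assume a: "a \<in> carrier A"
      have "a \<otimes>\<^bsub>A\<^esub> inv\<^bsub>A\<^esub> (s (f a)) \<in> k ` carrier X"
        unfolding D(9) using a by (simp add: kernel_def D(10))
      then obtain x where x: "x \<in> carrier X" "k x = a \<otimes>\<^bsub>A\<^esub> inv\<^bsub>A\<^esub> (s (f a))"
        by (metis imageE)
      then have "ident A k s (x, f a) = a" using a by (simp add: ident_def f.G.m_assoc)
      then show "a \<in> ident A k s ` (carrier X \<times> carrier B)"
        using x a by (metis SigmaI f.hom_closed image_eqI)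
    qed (auto simp: ident_def)
  qed
  ultimately show ?thesis by (simp add: iso_def semidirect_def)
qed

end

theory Submission
  imports Defs
begin

text \<open>
  For (1), $s(f(a)) \le a$ for $a = k(x) + s(b)$ means $s(b) \le k(x) + s(b)$, that is
  $x \ge 0$. For (2), the generated cone $Q$ is contained in $P$, and $A$ reordered by $Q$ is a
  subobject of $A$ through which $k$ and $s$ factor; if the point is strong, this forces $P = Q$.
  Conversely, a subobject $M$ through which $k$ and $s$ factor is all of $A$ as a group, and the
  image of its positive cone is a positive cone containing $P_{\prod}$, so that it contains
  $P$ as soon as $P$ is minimal.
\<close>

section \<open>Positive cones and group orders\<close>

lemma positive_coneI:
  assumes "P \<subseteq> carrier G" "\<one>\<^bsub>G\<^esub> \<in> P"
    and "\<And>x y. x \<in> P \<Longrightarrow> y \<in> P \<Longrightarrow> x \<otimes>\<^bsub>G\<^esub> y \<in> P"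
    and "\<And>g x. g \<in> carrier G \<Longrightarrow> x \<in> P \<Longrightarrow> g \<otimes>\<^bsub>G\<^esub> x \<otimes>\<^bsub>G\<^esub> inv\<^bsub>G\<^esub> g \<in> P"
  shows "positive_cone G P"
  using assms by (simp add: positive_cone_def submonoid_def)

lemma positive_coneD:
  assumes "positive_cone G P"
  shows "P \<subseteq> carrier G" "\<one>\<^bsub>G\<^esub> \<in> P"
    and "\<And>x y. x \<in> P \<Longrightarrow> y \<in> P \<Longrightarrow> x \<otimes>\<^bsub>G\<^esub> y \<in> P"
    and "\<And>g x. g \<in> carrier G \<Longrightarrow> x \<in> P \<Longrightarrow> g \<otimes>\<^bsub>G\<^esub> x \<otimes>\<^bsub>G\<^esub> inv\<^bsub>G\<^esub> g \<in> P"
  using assms by (simp_all add: positive_cone_def submonoid_def)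

lemma gen_cone_superset: "S \<subseteq> gen_cone G S"
  by (auto simp: gen_cone_def)

lemma gen_cone_least: "positive_cone G P \<Longrightarrow> S \<subseteq> P \<Longrightarrow> gen_cone G S \<subseteq> P"
  by (auto simp: gen_cone_def)

lemma (in group) positive_cone_carrier: "positive_cone G (carrier G)"
  by (rule positive_coneI) auto

text \<open>The whole group is among the cones being intersected, which keeps the intersection
  inside the carrier; over an empty family it would be \<open>UNIV\<close>.\<close>

lemma (in group) positive_cone_gen_cone:
  assumes "S \<subseteq> carrier G"
  shows "positive_cone G (gen_cone G S)"
proof (rule positive_coneI)
  show "gen_cone G S \<subseteq> carrier G"
    by (rule gen_cone_least[OF positive_cone_carrier assms])
qed (auto simp: gen_cone_def dest: positive_coneD)

section \<open>Cones under homomorphisms\<close>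

lemma (in group_hom) positive_cone_vimage:
  assumes "positive_cone H Q"
  shows "positive_cone G {x \<in> carrier G. h x \<in> Q}"
  by (rule positive_coneI) (auto simp: positive_coneD[OF assms])

text \<open>Surjectivity serves the closure under conjugation: a conjugating element of
  \<open>H\<close> has to be lifted to \<open>G\<close>.\<close>

lemma (in group_hom) positive_cone_image:
  assumes P: "positive_cone G P" and surj: "h ` carrier G = carrier H"
  shows "positive_cone H (h ` P)"
proof (rule positive_coneI)
  note D = positive_coneD[OF P]
  show "h ` P \<subseteq> carrier H" using D(1) by auto
  show "\<one>\<^bsub>H\<^esub> \<in> h ` P" using D(2) hom_one by (metis image_eqI)
  show "x \<otimes>\<^bsub>H\<^esub> y \<in> h ` P" if xy: "x \<in> h ` P" "y \<in> h ` P" for x y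
  proof -
    obtain u v where uv: "u \<in> P" "v \<in> P" "x = h u" "y = h v" using xy by blast
    then have "u \<in> carrier G" "v \<in> carrier G" using D(1) by auto
    with uv show ?thesis using D(3) by (intro image_eqI[of _ _ "u \<otimes>\<^bsub>G\<^esub> v"]) simp_all
  qed
  show "g \<otimes>\<^bsub>H\<^esub> x \<otimes>\<^bsub>H\<^esub> inv\<^bsub>H\<^esub> g \<in> h ` P" if gx: "g \<in> carrier H" "x \<in> h ` P" for g x
  proof -
    obtain u v where uv: "u \<in> carrier G" "v \<in> P" "g = h u" "x = h v"
      using gx unfolding surj[symmetric] by blast
    then have "v \<in> carrier G" using D(1) by auto
    with uv show ?thesis
      using D(4) by (intro image_eqI[of _ _ "u \<otimes>\<^bsub>G\<^esub> v \<otimes>\<^bsub>G\<^esub> inv\<^bsub>G\<^esub> u"]) simp_all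
  qed
qed

text \<open>Minimality is used once on each side: the preimage of the cone generated by the image of
  \<open>S\<close> is a cone containing \<open>S\<close>, and the image of the cone generated by
  \<open>S\<close> is a cone containing the image of \<open>S\<close>.\<close>

lemma (in group_hom) image_gen_cone:
  assumes S: "S \<subseteq> carrier G" and surj: "h ` carrier G = carrier H"
  shows "h ` gen_cone G S = gen_cone H (h ` S)"
proof
  have hS: "h ` S \<subseteq> carrier H" using S by auto
  have "gen_cone G S \<subseteq> {x \<in> carrier G. h x \<in> gen_cone H (h ` S)}"
    using S gen_cone_superset[of "h ` S" H]
    by (intro gen_cone_least positive_cone_vimage H.positive_cone_gen_cone hS) auto
  then show "h ` gen_cone G S \<subseteq> gen_cone H (h ` S)" by auto
  show "gen_cone H (h ` S) \<subseteq> h ` gen_cone G S"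
    by (intro gen_cone_least positive_cone_image G.positive_cone_gen_cone S surj
        image_mono gen_cone_superset)
qed

section \<open>The order determined by its cone\<close>

context ordered_group
begin

lemma refl: "x \<in> carrier G \<Longrightarrow> x \<preceq> x"
  using le_refl by (auto simp: reflp_on_def)

lemma le_iff_pos_cone:
  assumes "x \<in> carrier G" "y \<in> carrier G"
  shows "x \<preceq> y \<longleftrightarrow> y \<otimes> inv x \<in> pos_cone G"
proof
  assume "x \<preceq> y"
  then show "y \<otimes> inv x \<in> pos_cone G"
    using mult_mono[of x y "inv x" "inv x"] assms refl by (simp add: pos_cone_def)
next
  assume "y \<otimes> inv x \<in> pos_cone G"
  then show "x \<preceq> y"
    using mult_mono[of \<one> "y \<otimes> inv x" x x] assms refl by (simp add: pos_cone_def m_assoc)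
qed

lemma positive_cone_pos_cone: "positive_cone G (pos_cone G)"
proof (rule positive_coneI)
  show "x \<otimes> y \<in> pos_cone G" if "x \<in> pos_cone G" "y \<in> pos_cone G" for x y
    using mult_mono[of \<one> x \<one> y] that by (simp add: pos_cone_def)
  show "g \<otimes> x \<otimes> inv g \<in> pos_cone G" if "g \<in> carrier G" "x \<in> pos_cone G" for g x
  proof -
    have "g \<otimes> \<one> \<otimes> inv g \<preceq> g \<otimes> x \<otimes> inv g"
      using that by (intro mult_mono refl) (auto simp: pos_cone_def)
    then show ?thesis using that by (simp add: pos_cone_def)
  qed
qed (auto simp: pos_cone_def refl)

end

text \<open>A homomorphism carries the difference y - x to h(y) - h(x), so monotonicity only has to
  be tested on differences, that is, on positive elements.\<close>

lemma ordhom_iff_pos_cone: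
  assumes G: "ordered_group G" and H: "ordered_group H"
  shows "h \<in> ordhom G H \<longleftrightarrow> h \<in> hom G H \<and> h ` pos_cone G \<subseteq> pos_cone H"
proof (cases "h \<in> hom G H")
  case True
  interpret G: ordered_group G by (rule G)
  interpret H: ordered_group H by (rule H)
  interpret group_hom G H h using True by unfold_locales
  have "h x \<preceq>\<^bsub>H\<^esub> h y"
    if "h ` pos_cone G \<subseteq> pos_cone H" "x \<in> carrier G" "y \<in> carrier G" "x \<preceq>\<^bsub>G\<^esub> y" for x y
  proof -
    have "h (y \<otimes>\<^bsub>G\<^esub> inv\<^bsub>G\<^esub> x) \<in> pos_cone H" using that G.le_iff_pos_cone by blast
    then show ?thesis using that by (simp add: H.le_iff_pos_cone)
  qed
  moreover have "h x \<in> pos_cone H" if "h \<in> ordhom G H" "x \<in> pos_cone G" for x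
    using ordhomD(4)[OF that(1), of "\<one>\<^bsub>G\<^esub>" x] that(2) by (simp add: pos_cone_def)
  ultimately show ?thesis using True by (auto simp: ordhom_def)
qed (simp add: ordhom_def)

section \<open>Reordering a group by a cone\<close>

text \<open>Only the order of \<open>G\<close> is replaced, so the identity function can serve as a
  comparison with \<open>G\<close>. For a cone \<open>Q\<close>, closure under conjugation makes the
  choice of y - x rather than -x + y immaterial.\<close>

definition cone_order :: "'a ordgrp \<Rightarrow> 'a set \<Rightarrow> 'a ordgrp" where
  "cone_order G Q = G\<lparr>le := (\<lambda>x y. y \<otimes>\<^bsub>G\<^esub> inv\<^bsub>G\<^esub> x \<in> Q)\<rparr>"

lemma cone_order_simps [simp]:
  "carrier (cone_order G Q) = carrier G" "mult (cone_order G Q) = mult G"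
  "one (cone_order G Q) = one G"
  "le (cone_order G Q) x y \<longleftrightarrow> y \<otimes>\<^bsub>G\<^esub> inv\<^bsub>G\<^esub> x \<in> Q"
  by (simp_all add: cone_order_def)

lemma hom_cone_order [simp]:
  "hom (cone_order G Q) H = hom G H" "hom H (cone_order G Q) = hom H G"
  by (simp_all add: hom_def)

context
  fixes G :: "'a ordgrp" (structure) and Q :: "'a set"
  assumes G: "group G" and Q: "positive_cone G Q"
begin

interpretation group G by (rule G)

lemma ordered_group_cone_order: "ordered_group (cone_order G Q)"
proof (intro ordered_group.intro ordered_group_axioms.intro)
  note D = positive_coneD[OF Q]
  show "group (cone_order G Q)"
    by (rule groupI) (auto simp: m_assoc intro: l_inv_ex)
  show "reflp_on (carrier (cone_order G Q)) (le (cone_order G Q))"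
    using D(2) by (auto simp: reflp_on_def)
  show "transp_on (carrier (cone_order G Q)) (le (cone_order G Q))"
  proof (rule transp_onI, simp)
    fix x y z assume c: "x \<in> carrier G" "y \<in> carrier G" "z \<in> carrier G"
      and "y \<otimes> inv x \<in> Q" "z \<otimes> inv y \<in> Q"
    then have "(z \<otimes> inv y) \<otimes> (y \<otimes> inv x) \<in> Q" using D(3) by blast
    moreover have "(z \<otimes> inv y) \<otimes> (y \<otimes> inv x) = z \<otimes> inv x"
      using c by (simp add: m_assoc) (simp flip: m_assoc)
    ultimately show "z \<otimes> inv x \<in> Q" by simp
  qed
  fix x x' y y'
  assume "x \<in> carrier (cone_order G Q)" "x' \<in> carrier (cone_order G Q)"
    "y \<in> carrier (cone_order G Q)" "y' \<in> carrier (cone_order G Q)"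
    "x \<preceq>\<^bsub>cone_order G Q\<^esub> x'" "y \<preceq>\<^bsub>cone_order G Q\<^esub> y'"
  then have c: "x \<in> carrier G" "x' \<in> carrier G" "y \<in> carrier G" "y' \<in> carrier G"
    and "x' \<otimes> inv x \<in> Q" "y' \<otimes> inv y \<in> Q" by simp_all
  \<comment> \<open>Without commutativity the difference of the sums is (x' + (y' - y) - x') + (x' -
    x): the first summand is a conjugate of a member of \<open>Q\<close>.\<close>
  then have "(x' \<otimes> (y' \<otimes> inv y) \<otimes> inv x') \<otimes> (x' \<otimes> inv x) \<in> Q" using D(3,4) by blast
  moreover have "(x' \<otimes> (y' \<otimes> inv y) \<otimes> inv x') \<otimes> (x' \<otimes> inv x) = (x' \<otimes> y') \<otimes> inv (x \<otimes> y)"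
    using c by (simp add: m_assoc inv_mult_group) (simp flip: m_assoc)
  ultimately show "x \<otimes>\<^bsub>cone_order G Q\<^esub> y \<preceq>\<^bsub>cone_order G Q\<^esub> x' \<otimes>\<^bsub>cone_order G Q\<^esub> y'"
    by simp
qed

lemma pos_cone_cone_order [simp]: "pos_cone (cone_order G Q) = Q"
  using positive_coneD(1)[OF Q] by (auto simp: pos_cone_def)

end

section \<open>Split extensions\<close>

context
  fixes X :: "'x ordgrp" and A :: "'a ordgrp" and B :: "'b ordgrp"
    and k :: "'x \<Rightarrow> 'a" and f :: "'a \<Rightarrow> 'b" and s :: "'b \<Rightarrow> 'a"
  assumes ext: "split_extension X A B k f s"
begin

interpretation X: ordered_group X by (rule split_extensionD[OF ext])
interpretation A: ordered_group A by (rule split_extensionD[OF ext])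
interpretation B: ordered_group B by (rule split_extensionD[OF ext])
interpretation f: group_hom A B f
  by (rule ordhom_group_hom[OF A.ordered_group_axioms B.ordered_group_axioms split_extensionD(5)[OF ext]])
interpretation k: group_hom X A k
  by (rule ordhom_group_hom[OF X.ordered_group_axioms A.ordered_group_axioms split_extensionD(4)[OF ext]])
interpretation s: group_hom B A s
  by (rule ordhom_group_hom[OF B.ordered_group_axioms A.ordered_group_axioms split_extensionD(6)[OF ext]])

section \<open>The cone of the middle object in the semidirect product\<close>

text \<open>The group laws are transported from \<open>A\<close> along the inverse of
  \<open>ident\<close>, so that no action laws for \<open>conj_action\<close> have to be
  checked.\<close>

lemma group_semidirect: "group (semidirect X (conj_action X A k s) B)" (is "group ?S")
proof -
  let ?h = "ident A k s" and ?n = "inv_into (carrier ?S) (ident A k s)"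
  have one: "\<one>\<^bsub>?S\<^esub> \<in> carrier ?S" "?h \<one>\<^bsub>?S\<^esub> = \<one>\<^bsub>A\<^esub>"
    by (simp_all add: semidirect_def ident_def)
  have bij: "bij_betw ?h (carrier ?S) (carrier A)" and hom: "?h \<in> hom ?S A"
    using ident_iso[OF ext] by (simp_all add: iso_def)
  have inj: "inj_on ?h (carrier ?S)" and surj: "?h ` carrier ?S = carrier A"
    using bij by (simp_all add: bij_betw_def)
  have closed: "p \<otimes>\<^bsub>?S\<^esub> q \<in> carrier ?S" if "p \<in> carrier ?S" "q \<in> carrier ?S" for p q
    using that conj_action(1)[OF ext] by (auto simp: semidirect_def)
  have "?n \<in> hom A ?S"
  proof (rule homI)
    show "?n a \<in> carrier ?S" if "a \<in> carrier A" for a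
      using that surj by (simp add: inv_into_into)
    fix a b assume "a \<in> carrier A" "b \<in> carrier A"
    then obtain p q where pq: "p \<in> carrier ?S" "q \<in> carrier ?S" "a = ?h p" "b = ?h q"
      unfolding surj[symmetric] by blast
    then have "?n (a \<otimes>\<^bsub>A\<^esub> b) = ?n (?h (p \<otimes>\<^bsub>?S\<^esub> q))"
      using hom_mult[OF hom] by simp
    then show "?n (a \<otimes>\<^bsub>A\<^esub> b) = ?n a \<otimes>\<^bsub>?S\<^esub> ?n b"
      using pq closed by (simp add: inv_into_f_f[OF inj])
  qed
  then have "?n \<in> iso A ?S" using bij_betw_inv_into[OF bij] by (simp add: iso_def)
  \<comment> \<open>Transport yields a group whose unit is the image of the unit of
    \<open>A\<close>; this equation identifies it with the unit written in
    \<open>semidirect\<close>.\<close>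
  moreover have "?n \<one>\<^bsub>A\<^esub> = \<one>\<^bsub>?S\<^esub>"
    using inv_into_f_f[OF inj one(1)] one(2) by simp
  ultimately show ?thesis using A.iso_imp_img_group by fastforce
qed

lemma pos_prod_subset: "pos_cone X \<times> pos_cone B \<subseteq> ident_cone X A B k s"
proof -
  have "k ` pos_cone X \<subseteq> pos_cone A" "s ` pos_cone B \<subseteq> pos_cone A"
    using split_extensionD(4,6)[OF ext]
    by (simp_all add: ordhom_iff_pos_cone X.ordered_group_axioms A.ordered_group_axioms
        B.ordered_group_axioms)
  then show ?thesis
    using positive_coneD(3)[OF A.positive_cone_pos_cone]
    by (auto simp: ident_cone_def ident_def image_subset_iff pos_cone_def)
qed

text \<open>A kernel carries the induced order, so \<open>k\<close> reflects positivity as well as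
  preserving it.\<close>

lemma kernel_pos_iff: "x \<in> carrier X \<Longrightarrow> k x \<in> pos_cone A \<longleftrightarrow> x \<in> pos_cone X"
  using split_extensionD(7)[OF ext] k.hom_one X.one_closed
  unfolding is_kernel_def pos_cone_def by auto

text \<open>The difference (k(x) + s(b)) - s(b) is k(x), whose positivity is decided in the
  kernel.\<close>

lemma section_le_iff:
  assumes x: "x \<in> carrier X" and b: "b \<in> carrier B"
  shows "s (f (ident A k s (x, b))) \<preceq>\<^bsub>A\<^esub> ident A k s (x, b) \<longleftrightarrow> x \<in> pos_cone X"
proof -
  have "k x \<otimes>\<^bsub>A\<^esub> s b \<otimes>\<^bsub>A\<^esub> inv\<^bsub>A\<^esub> (s b) = k x"
    using x b by (simp add: A.m_assoc del: s.hom_inv)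
  then show ?thesis
    using x b ident_maps(3)[OF ext x b]
    by (simp add: A.le_iff_pos_cone kernel_pos_iff ident_def del: s.hom_inv)
qed

lemma ident_image_cone: "ident A k s ` ident_cone X A B k s = pos_cone A"
proof -
  have "ident A k s ` (carrier X \<times> carrier B) = carrier A"
    using ident_iso[OF ext] by (simp add: iso_def bij_betw_def semidirect_def)
  then show ?thesis by (auto simp: ident_cone_def pos_cone_def)
qed

section \<open>The rali condition\<close>

text \<open>Monotonicity of \<open>f\<close> already makes the second component of every element of
  the cone positive, and the product cone always lies inside it. Hence equality only concerns the
  first component, which is what the rali inequality controls.\<close>

lemma rali_iff_cone: "rali A B f s \<longleftrightarrow> ident_cone X A B k s = pos_cone X \<times> pos_cone B"
proof -
  have "f ` pos_cone A \<subseteq> pos_cone B"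
    using split_extensionD(5)[OF ext]
    by (simp add: ordhom_iff_pos_cone A.ordered_group_axioms B.ordered_group_axioms)
  then have snd: "b \<in> pos_cone B" if "(x, b) \<in> ident_cone X A B k s" for x b
    using that ident_maps(3)[OF ext] by (force simp: ident_cone_def)
  have "rali A B f s \<longleftrightarrow> (\<forall>a\<in>pos_cone A. s (f a) \<preceq>\<^bsub>A\<^esub> a)"
    using split_extensionD(10)[OF ext] by (simp add: rali_def hom_le_def)
  also have "\<dots> \<longleftrightarrow> (\<forall>p\<in>ident_cone X A B k s. fst p \<in> pos_cone X)"
    unfolding ident_image_cone[symmetric]
    using section_le_iff by (auto simp: ident_cone_def)
  also have "\<dots> \<longleftrightarrow> ident_cone X A B k s = pos_cone X \<times> pos_cone B"
    using snd pos_prod_subset by auto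
  finally show ?thesis .
qed

section \<open>Strong points\<close>

text \<open>The product cone is moved into \<open>A\<close> because strength is tested on subobjects
  of \<open>A\<close>.\<close>

abbreviation (input) "Pi_A \<equiv> ident A k s ` (pos_cone X \<times> pos_cone B)"

lemma Pi_A_subset: "Pi_A \<subseteq> pos_cone A"
  using pos_prod_subset ident_image_cone by blast

text \<open>A group isomorphism carries generated cones to generated cones, and its injectivity lets
  equality of two subsets be tested on their images.\<close>

lemma cone_generated_iff:
  "ident_cone X A B k s = gen_cone (semidirect X (conj_action X A k s) B) (pos_cone X \<times> pos_cone B)
    \<longleftrightarrow> pos_cone A = gen_cone A Pi_A"
  (is "?P = gen_cone ?S ?\<Pi> \<longleftrightarrow> _")
proof -
  interpret S: group ?S by (rule group_semidirect)
  interpret i: group_hom ?S A "ident A k s"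
    using ident_iso[OF ext] by unfold_locales (simp add: iso_def)
  have bij: "bij_betw (ident A k s) (carrier ?S) (carrier A)"
    using ident_iso[OF ext] by (simp add: iso_def)
  have \<Pi>: "?\<Pi> \<subseteq> carrier ?S" by (auto simp: semidirect_def pos_cone_def)
  have "?P = gen_cone ?S ?\<Pi> \<longleftrightarrow> ident A k s ` ?P = ident A k s ` gen_cone ?S ?\<Pi>"
    using bij positive_coneD(1)[OF S.positive_cone_gen_cone[OF \<Pi>]]
    by (intro inj_on_image_eq_iff[symmetric, of _ "carrier ?S"])
      (auto simp: bij_betw_def ident_cone_def semidirect_def)
  then show ?thesis
    using i.image_gen_cone[OF \<Pi>] bij by (simp add: ident_image_cone bij_betw_def)
qed

lemma generated_if_jointly_strongly_epi:
  assumes epi: "jointly_strongly_epi X B A k s"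
  shows "pos_cone A = gen_cone A Pi_A"
proof
  let ?Q = "gen_cone A Pi_A"
  show "?Q \<subseteq> pos_cone A"
    by (rule gen_cone_least[OF A.positive_cone_pos_cone Pi_A_subset])
  have Pi_Q: "ident A k s (x, b) \<in> ?Q" if "x \<in> pos_cone X" "b \<in> pos_cone B" for x b
    using that gen_cone_superset[of Pi_A A] by blast
  have Q: "positive_cone A ?Q"
    using Pi_A_subset by (intro A.positive_cone_gen_cone) (auto simp: pos_cone_def)
  let ?M = "cone_order A ?Q"
  have M: "ordered_group ?M" by (rule ordered_group_cone_order[OF A.group_axioms Q])
  have posM: "pos_cone ?M = ?Q" by (rule pos_cone_cone_order[OF A.group_axioms Q])
  have ids: "(\<lambda>x. x) \<in> hom A A" by (simp add: hom_def)
  have "(\<lambda>x. x) \<in> ordhom ?M A"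
    using ids \<open>?Q \<subseteq> pos_cone A\<close>
    by (simp add: ordhom_iff_pos_cone M A.ordered_group_axioms posM)
  then have "ordmono ?M A (\<lambda>x. x)"
    by (simp add: ordmono_iff M A.ordered_group_axioms)
  \<comment> \<open>Here \<open>k x\<close> is the element (x, 0), and 0 is positive in
    \<open>B\<close>; the case of \<open>s\<close> below is symmetric.\<close>
  moreover have "k ` pos_cone X \<subseteq> ?Q"
    using Pi_Q[OF _ positive_coneD(2)[OF B.positive_cone_pos_cone]] ident_maps(1)[OF ext]
    by (force simp: pos_cone_def)
  then have "factors_through X ?M k (\<lambda>x. x)"
    unfolding factors_through_def
    by (intro bexI[of _ k])
      (simp_all add: ordhom_iff_pos_cone M X.ordered_group_axioms posM k.homh)
  moreover have "s ` pos_cone B \<subseteq> ?Q"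
    using Pi_Q[OF positive_coneD(2)[OF X.positive_cone_pos_cone]] ident_maps(2)[OF ext]
    by (force simp: pos_cone_def)
  then have "factors_through B ?M s (\<lambda>x. x)"
    unfolding factors_through_def
    by (intro bexI[of _ s])
      (simp_all add: ordhom_iff_pos_cone M B.ordered_group_axioms posM s.homh)
  ultimately have "ordiso ?M A (\<lambda>x. x)"
    using epi M unfolding jointly_strongly_epi_def by blast
  \<comment> \<open>The inverse of the identity function is again the identity on the carrier, and
    its monotonicity is exactly the missing inclusion.\<close>
  then obtain h where "h \<in> ordhom A ?M" "\<forall>y\<in>carrier A. h y = y"
    by (auto simp: ordiso_def)
  then show "pos_cone A \<subseteq> ?Q"
    by (force simp: ordhom_iff_pos_cone M A.ordered_group_axioms posM pos_cone_def[of A])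
qed

lemma jointly_strongly_epi_if_generated:
  assumes gen: "pos_cone A = gen_cone A Pi_A"
  shows "jointly_strongly_epi X B A k s"
  unfolding jointly_strongly_epi_def
proof (intro allI impI)
  fix M :: "'a ordgrp" and m
  assume M: "ordered_group M" and mono: "ordmono M A m"
    and fk: "factors_through X M k m" and fs: "factors_through B M s m"
  interpret M: ordered_group M by (rule M)
  have m: "m \<in> ordhom M A" and inj: "inj_on m (carrier M)"
    using mono ordmono_iff[OF M A.ordered_group_axioms] by auto
  interpret m: group_hom M A m by (rule ordhom_group_hom[OF M A.ordered_group_axioms m])
  obtain k' where k': "k' \<in> ordhom X M" "\<And>x. x \<in> carrier X \<Longrightarrow> m (k' x) = k x"
    using fk by (auto simp: factors_through_def)
  obtain s' where s': "s' \<in> ordhom B M" "\<And>b. b \<in> carrier B \<Longrightarrow> m (s' b) = s b"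
    using fs by (auto simp: factors_through_def)
  have lift: "m (k' x \<otimes>\<^bsub>M\<^esub> s' b) = ident A k s (x, b)" if "x \<in> carrier X" "b \<in> carrier B" for x b
    using that k' s' ordhomD(2)[OF k'(1)] ordhomD(2)[OF s'(1)] by (simp add: ident_def)
  \<comment> \<open>Every element of \<open>A\<close> has the form k(x) + s(b), and the
    factorizations lift both summands to \<open>M\<close>.\<close>
  have surj: "m ` carrier M = carrier A"
  proof (intro equalityI subsetI)
    fix a assume "a \<in> carrier A"
    moreover have "ident A k s ` (carrier X \<times> carrier B) = carrier A"
      using ident_iso[OF ext] by (simp add: iso_def bij_betw_def semidirect_def)
    ultimately obtain x b where "x \<in> carrier X" "b \<in> carrier B" "a = ident A k s (x, b)"
      by blast
    then show "a \<in> m ` carrier M"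
      using lift ordhomD(2)[OF k'(1)] ordhomD(2)[OF s'(1)] by (metis M.m_closed image_eqI)
  qed auto
  have "Pi_A \<subseteq> m ` pos_cone M"
  proof clarify
    fix x b assume xb: "x \<in> pos_cone X" "b \<in> pos_cone B"
    then have "k' x \<in> pos_cone M" "s' b \<in> pos_cone M"
      using k'(1) s'(1)
      by (auto simp: ordhom_iff_pos_cone M X.ordered_group_axioms B.ordered_group_axioms)
    then have "k' x \<otimes>\<^bsub>M\<^esub> s' b \<in> pos_cone M"
      by (rule positive_coneD(3)[OF M.positive_cone_pos_cone])
    then show "ident A k s (x, b) \<in> m ` pos_cone M"
      using lift xb by (metis (no_types, lifting) image_eqI mem_Collect_eq pos_cone_def)
  qed
  \<comment> \<open>As \<open>m\<close> is surjective, the image of the positive cone of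
    \<open>M\<close> is closed under conjugation in \<open>A\<close>, so minimality applies to
    it.\<close>
  then have pos: "pos_cone A \<subseteq> m ` pos_cone M"
    unfolding gen
    by (intro gen_cone_least m.positive_cone_image M.positive_cone_pos_cone surj)
  define n where "n = inv_into (carrier M) m"
  have "n \<in> iso A M"
    using inj surj m.homh unfolding n_def by (intro M.iso_set_sym) (simp add: iso_def bij_betw_def)
  moreover have nm: "n (m x) = x" if "x \<in> carrier M" for x
    using inj that by (simp add: n_def)
  \<comment> \<open>A positive element of \<open>A\<close> is the image of a positive element of
    \<open>M\<close>, and \<open>n\<close> returns that same element since \<open>m\<close> is
    injective.\<close>
  then have "n ` pos_cone A \<subseteq> pos_cone M"
    using pos by (force simp: pos_cone_def[of M])
  ultimately have "n \<in> ordhom A M"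
    by (simp add: ordhom_iff_pos_cone M A.ordered_group_axioms iso_def)
  moreover have "m (n a) = a" if "a \<in> carrier A" for a
    using that surj by (simp add: n_def f_inv_into_f)
  ultimately show "ordiso M A m" using m nm unfolding ordiso_def by blast
qed

end

theorem lemma4p1:
  fixes X :: "'x ordgrp" and A :: "'a ordgrp" and B :: "'b ordgrp"
    and k :: "'x \<Rightarrow> 'a" and f :: "'a \<Rightarrow> 'b" and s :: "'b \<Rightarrow> 'a"
    and \<phi> :: "'b \<Rightarrow> 'x \<Rightarrow> 'x" and P P\<^sub>\<Pi> :: "('x \<times> 'b) set"
  assumes ext: "split_extension X A B k f s"
    and \<phi>: "\<phi> = conj_action X A k s"
    and P: "P = ident_cone X A B k s"
    and P_prod: "P\<^sub>\<Pi> = pos_cone X \<times> pos_cone B"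
  shows "(rali A B f s \<longleftrightarrow> P = P\<^sub>\<Pi>) \<and>
    (strong_point X A B k f s \<longleftrightarrow> P = gen_cone (semidirect X \<phi> B) P\<^sub>\<Pi>)"
proof
  show "rali A B f s \<longleftrightarrow> P = P\<^sub>\<Pi>"
    unfolding P P_prod by (rule rali_iff_cone[OF ext])
  have "strong_point X A B k f s \<longleftrightarrow> jointly_strongly_epi X B A k s"
    using split_extensionD(7)[OF ext] by (simp add: strong_point_def)
  then show "strong_point X A B k f s \<longleftrightarrow> P = gen_cone (semidirect X \<phi> B) P\<^sub>\<Pi>"
    unfolding P P_prod \<phi> cone_generated_iff[OF ext]
    using generated_if_jointly_strongly_epi[OF ext] jointly_strongly_epi_if_generated[OF ext]
    by blast
qed

end
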